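(* Let $k\geq 1$ be an integer and let $R$ be a $(2k+1)$-potent ring, i.e. a ring such that $x^{2k+1}=x$ for all $x\in R$. Then $x^k\in Z(R)$ for all $x\in R$.
   Context: Rings are associative but are not assumed to have a unity. For an integer $n\geq 2$, a ring $R$ is called $n$-potent if $x^n=x$ for all $x\in R$. The centre of $R$ is $Z(R)=\{a\in R : ar=ra \text{ for all } r\in R\}$. *)

theory Defs
  imports Main
begin

text \<open>
  The type class \<^class>\<open>ring\<close> consists of associative rings that need not have a unity (and need
  not be commutative). The library power needs a unity, so positive powers are defined here by
  multiplication alone; a zeroth power has no meaning in such a ring and is left unspecified.
\<close>

fun pos_power :: "'a::semigroup_mult \<Rightarrow> nat \<Rightarrow> 'a" where
  "pos_power x (Suc 0) = x"
| "pos_power x (Suc (Suc n)) = x * pos_power x (Suc n)"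

definition potent_ring :: "nat \<Rightarrow> 'a::ring itself \<Rightarrow> bool" where
  "potent_ring n R \<longleftrightarrow> n \<ge> 2 \<and> (\<forall>x::'a. pos_power x n = x)"

definition ring_centre :: "'a::ring set" where
  "ring_centre = {a. \<forall>r. a * r = r * a}"

end

theory Submission
  imports Defs
begin

text \<open>
  A potent ring is reduced, and \<open>u = x\<^sup>k\<close> satisfies \<open>u\<^sup>3 = u\<close>. In a reduced ring \<open>a * b = 0\<close> forces
  \<open>b * r * a = 0\<close> for every \<open>r\<close>, and idempotents are central; so \<open>e = u\<^sup>2\<close> is central. From
  \<open>(u - e) * (u + e) = 0\<close> one gets \<open>(u - e) * r * (u + e) = 0\<close>, which says that \<open>u - e\<close>
  annihilates the commutator \<open>c = u * r - r * u\<close>. Hence \<open>c * u = c * e\<close> and \<open>c * r * u = c * r * e\<close>,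
  so \<open>c\<^sup>2 = c * e * r - c * r * e = 0\<close> and \<open>c = 0\<close>.
\<close>

text \<open>Squaring \<open>b * a\<close> or \<open>b * r * a\<close> brings the factor
  \<open>a * b\<close> into the middle, so both squares vanish. Once \<open>b * a = 0\<close> is
  known, exchanging \<open>a\<close> and \<open>b\<close> gives
  \<open>a * r * b = 0\<close>.\<close>

lemma reduced_mult_eq_0_sandwich:
  fixes a b r :: "'a::ring"
  assumes reduced: "\<And>y::'a. y * y = 0 \<Longrightarrow> y = 0" and "a * b = 0"
  shows "b * a = 0" and "b * r * a = 0" and "a * r * b = 0"
proof -
  have "b * s * a = 0" if "a * b = 0" for a b s :: 'a
  proof (rule reduced)
    have "(b * s * a) * (b * s * a) = b * s * (a * b) * (s * a)"
      by (simp only: mult.assoc)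
    with that show "(b * s * a) * (b * s * a) = 0" by simp
  qed
  moreover show ba: "b * a = 0"
  proof (rule reduced)
    have "(b * a) * (b * a) = b * (a * b) * a"
      by (simp only: mult.assoc)
    with assms(2) show "(b * a) * (b * a) = 0" by simp
  qed
  ultimately show "b * r * a = 0" "a * r * b = 0"
    using assms(2) by blast+
qed

lemma reduced_idempotent_central:
  fixes e r :: "'a::ring"
  assumes reduced: "\<And>y::'a. y * y = 0 \<Longrightarrow> y = 0" and e: "e * e = e"
  shows "e * r = r * e"
proof -
  have e': "e * (e * s) = e * s" for s
    using e by (simp flip: mult.assoc)
  \<comment> \<open>Both differences square to zero, so \<open>e * r\<close> and
    \<open>r * e\<close> equal \<open>e * r * e\<close>.\<close>
  have "e * r - e * r * e = 0" "r * e - e * r * e = 0"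
    by (rule reduced, simp add: algebra_simps e e')+
  then show ?thesis by simp
qed

lemma reduced_cube_eq_self_central:
  fixes u r :: "'a::ring"
  assumes reduced: "\<And>y::'a. y * y = 0 \<Longrightarrow> y = 0" and u: "u * u * u = u"
  shows "u * r = r * u"
proof -
  define e where "e = u * u"
  define c where "c = u * r - r * u"
  have eu: "e * u = u" and ue: "u * e = u" and ee: "e * e = e"
    using u by (simp_all add: e_def mult.assoc)
  have e_central: "e * s = s * e" for s
    using reduced ee by (rule reduced_idempotent_central)
  have "(u - e) * (u + e) = 0"
    by (simp add: algebra_simps eu ue ee flip: e_def)
  then have sandwich: "(u - e) * r * (u + e) = 0"
    using reduced reduced_mult_eq_0_sandwich(2,3) by blast
  have "(u - e) * c = - ((u - e) * r * (u + e))"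
  proof -
    \<comment> \<open>Centrality moves the right-hand \<open>e\<close> past \<open>r\<close>, where
      \<open>u\<close> or \<open>e\<close> absorbs it.\<close>
    have "u * r * e = u * r" "e * r * e = e * r"
      using e_central[of r] by (metis mult.assoc ue, metis mult.assoc ee)
    moreover have "u * (u * r) = e * r" "e * (u * r) = u * r"
      by (simp_all add: e_def u flip: mult.assoc)
    ultimately show ?thesis
      unfolding c_def by (simp add: algebra_simps)
  qed
  with sandwich have "(u - e) * c = 0" by simp
  then have "c * (u - e) = 0" "c * r * (u - e) = 0"
    using reduced reduced_mult_eq_0_sandwich(1,2) by blast+
  then have cu: "c * u = c * e" and cru: "c * r * u = c * r * e"
    by (simp_all add: right_diff_distrib)
  have "c * c = c * u * r - c * r * u"
    by (subst (2) c_def) (simp add: right_diff_distrib mult.assoc)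
  also have "\<dots> = 0"
    unfolding cu cru by (simp add: mult.assoc e_central[of r])
  finally have "c = 0" by (rule reduced)
  then show ?thesis by (simp add: c_def)
qed

lemma pos_power_Suc: "n > 0 \<Longrightarrow> pos_power x (Suc n) = x * pos_power x n"
  by (cases n) simp_all

lemma pos_power_add:
  assumes "m > 0" and "n > 0"
  shows "pos_power x (m + n) = pos_power x m * pos_power x n"
  using assms(1)
proof (induction m rule: nat_induct_non_zero)
  case 1
  then show ?case using assms(2) by (simp add: pos_power_Suc)
next
  case (Suc m)
  then show ?case by (simp add: pos_power_Suc mult.assoc)
qed

text \<open>As \<open>n \<ge> 2\<close>, the power \<open>pos_power y n = y\<close> has the factor
  \<open>y * y\<close>.\<close>

lemma potent_ring_reduced:
  fixes y :: "'a::ring"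
  assumes "potent_ring n TYPE('a)" and "y * y = 0"
  shows "y = 0"
proof -
  have "pos_power y n = y" "n \<ge> 2"
    using assms(1) by (auto simp: potent_ring_def)
  moreover obtain m where "n = Suc (Suc m)"
    using \<open>n \<ge> 2\<close> by (metis add_2_eq_Suc le_iff_add)
  ultimately show ?thesis
    using assms(2) by (cases m) (simp_all flip: mult.assoc)
qed

theorem lemma2p4:
  fixes k :: nat and x :: "'a::ring"
  assumes "k \<ge> 1"
    and "potent_ring (2 * k + 1) TYPE('a)"
  shows "pos_power x k \<in> ring_centre"
proof -
  let ?u = "pos_power x k"
  have x: "pos_power x (2 * k + 1) = x"
    using assms(2) by (simp add: potent_ring_def)
  have "?u * ?u * ?u = pos_power x (k + k + k)"
    using assms(1) by (simp add: pos_power_add)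
  also have "\<dots> = ?u"
  \<comment> \<open>The exponent splits as \<open>3 * k = (2 * k + 1) + (k - 1)\<close>, and the
    first part collapses to \<open>x\<close>. For \<open>k = 1\<close> the second part would be the
    unspecified zeroth power.\<close>
  proof (cases "k = 1")
    case True
    with x show ?thesis by (simp add: eval_nat_numeral)
  next
    case False
    with assms(1) have "k + k + k = (2 * k + 1) + (k - 1)" "k - 1 > 0" by simp_all
    then have "pos_power x (k + k + k) = x * pos_power x (k - 1)"
      using x pos_power_add[of "2 * k + 1" "k - 1" x] by (metis add_gr_0 zero_less_one)
    also have "\<dots> = ?u"
      using \<open>k - 1 > 0\<close> pos_power_Suc[of "k - 1" x] by simp
    finally show ?thesis .
  qed
  finally show ?thesis
    unfolding ring_centre_def
    using reduced_cube_eq_self_central potent_ring_reduced[OF assms(2)] by blast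
qed

end
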